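(* Let $\mathcal{H},\mathcal{K}$ be complex Hilbert spaces, let $A\in\mathbb{B}(\mathcal{H})$ be a positive operator satisfying $0<m\mathbf{1}_{\mathcal{H}}\le A\le M\mathbf{1}_{\mathcal{H}}$ for some scalars $m,M$ with $m<M$, and let $\Phi:\mathbb{B}(\mathcal{H})\to\mathbb{B}(\mathcal{K})$ be a normalized positive linear map. Then for every real $p$ with $2\le p<\infty$, $$\Phi\left(m^{\frac{A-M\mathbf{1}_{\mathcal{H}}}{M-m}}M^{\frac{m\mathbf{1}_{\mathcal{H}}-A}{M-m}}\right)^{p}\le \left(\frac{(M+m)^2}{4^{\frac{2}{p}}Mm}\right)^{p}\Phi(A)^{-p}.$$ In particular, $$\Phi\left(m^{\frac{A-M\mathbf{1}_{\mathcal{H}}}{M-m}}M^{\frac{m\mathbf{1}_{\mathcal{H}}-A}{M-m}}\right)^{2}\le \left(\frac{(M+m)^2}{4Mm}\right)^{2}\Phi(A)^{-2}.$$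
   Context: $\mathbb{B}(\mathcal{H})$ denotes the bounded linear operators on the complex Hilbert space $\mathcal{H}$, with identity $\mathbf{1}_{\mathcal{H}}$. An operator $A$ is positive ($0\le A$) if $\langle Ax,x\rangle\ge 0$ for all $x\in\mathcal{H}$; $0<A$ means $A$ is positive and invertible; for self-adjoint $A,B$, $A\le B$ means $0\le B-A$. A linear map $\Phi:\mathbb{B}(\mathcal{H})\to\mathbb{B}(\mathcal{K})$ is positive if $\Phi(A)\ge 0$ whenever $A\ge 0$, and normalized if $\Phi(\mathbf{1}_{\mathcal{H}})=\mathbf{1}_{\mathcal{K}}$. Functions of self-adjoint operators are defined by the continuous functional calculus; in particular $m^{\frac{A-M\mathbf{1}_{\mathcal{H}}}{M-m}}M^{\frac{m\mathbf{1}_{\mathcal{H}}-A}{M-m}}$ is $g(A)$ with $g(t)=m^{\frac{t-M}{M-m}}M^{\frac{m-t}{M-m}}$, $t\in[m,M]$. For an operator $X$, $\Phi(X)^{q}$ means $(\Phi(X))^{q}$. *)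

theory Defs
  imports "HOL-Analysis.Analysis" "HOL-Computational_Algebra.Polynomial"
begin

section \<open>Complex Hilbert spaces\<close>

class complex_vector = real_vector +
  fixes scaleC :: "complex \<Rightarrow> 'a \<Rightarrow> 'a"  (infixr \<open>*\<^sub>C\<close> 75)
  assumes scaleC_add_right: "a *\<^sub>C (x + y) = a *\<^sub>C x + a *\<^sub>C y"
    and scaleC_add_left: "(a + b) *\<^sub>C x = a *\<^sub>C x + b *\<^sub>C x"
    and scaleC_scaleC: "a *\<^sub>C b *\<^sub>C x = (a * b) *\<^sub>C x"
    and scaleR_scaleC: "r *\<^sub>R x = complex_of_real r *\<^sub>C x"

lemma scaleC_one: "1 *\<^sub>C x = (x :: 'a :: complex_vector)"
  using scaleR_scaleC[of 1 x] by simp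

global_interpretation complex_vector: vector_space "scaleC :: complex \<Rightarrow> 'a \<Rightarrow> 'a :: complex_vector"
  by unfold_locales (auto simp: scaleC_add_right scaleC_add_left scaleC_scaleC scaleC_one)

abbreviation clinear :: "('a :: complex_vector \<Rightarrow> 'b :: complex_vector) \<Rightarrow> bool" where
  "clinear \<equiv> Vector_Spaces.linear scaleC scaleC"

text \<open>
  The complex inner product is linear in the first argument. Its real part is the inner product of
  the underlying real inner product space, from which it inherits positive definiteness
  and the norm; see \<open>cinner_self\<close> below.
\<close>

class complex_inner = complex_vector + real_inner +
  fixes cinner :: "'a \<Rightarrow> 'a \<Rightarrow> complex"
  assumes cinner_commute: "cinner x y = cnj (cinner y x)"
    and cinner_add_left: "cinner (x + y) z = cinner x z + cinner y z"
    and cinner_scaleC_left: "cinner (c *\<^sub>C x) y = c * cinner x y"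
    and inner_eq_Re_cinner: "inner x y = Re (cinner x y)"

class chilbert_space = complex_inner + complete_space

lemma cinner_self: "cinner x x = complex_of_real ((norm x)\<^sup>2)"
  for x :: "'a :: complex_inner"
proof -
  have "Im (cinner x x) = 0"
    using arg_cong[OF cinner_commute[of x x], of Im] by simp
  moreover have "Re (cinner x x) = (norm x)\<^sup>2"
    by (simp add: power2_norm_eq_inner inner_eq_Re_cinner)
  ultimately show ?thesis by (simp add: complex_eq_iff)
qed

lemma cinner_scaleC_right: "cinner x (c *\<^sub>C y) = cnj c * cinner x y"
  for x y :: "'a :: complex_inner"
  by (metis cinner_commute cinner_scaleC_left complex_cnj_mult)

lemma cinner_add_right: "cinner x (y + z) = cinner x y + cinner x z"
  for x y z :: "'a :: complex_inner"
  by (metis cinner_commute cinner_add_left complex_cnj_add)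

lemma norm_scaleC: "norm (c *\<^sub>C x) = cmod c * norm x"
  for x :: "'a :: complex_inner"
proof -
  have "cinner (c *\<^sub>C x) (c *\<^sub>C x) = (c * cnj c) * cinner x x"
    by (simp add: cinner_scaleC_left cinner_scaleC_right mult_ac)
  also have "\<dots> = complex_of_real ((cmod c * norm x)\<^sup>2)"
    by (simp only: cinner_self complex_norm_square[symmetric] power_mult_distrib of_real_mult)
  finally have "complex_of_real ((norm (c *\<^sub>C x))\<^sup>2) = complex_of_real ((cmod c * norm x)\<^sup>2)"
    by (simp only: cinner_self)
  then show ?thesis
    unfolding of_real_eq_iff by (metis norm_ge_zero power2_eq_imp_eq mult_nonneg_nonneg)
qed

lemma cinner_0_left: "cinner 0 x = 0"
  for x :: "'a :: complex_inner"
  using cinner_add_left[of 0 0 x] by simp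

lemma cinner_minus_left: "cinner (- x) y = - cinner x y"
  for x y :: "'a :: complex_inner"
  using cinner_add_left[of x "- x" y] by (simp add: cinner_0_left eq_neg_iff_add_eq_0 add.commute)

instantiation complex :: chilbert_space
begin
definition scaleC_complex :: "complex \<Rightarrow> complex \<Rightarrow> complex" where "scaleC_complex = (*)"
definition cinner_complex :: "complex \<Rightarrow> complex \<Rightarrow> complex" where "cinner_complex x y = x * cnj y"
instance
  by standard (auto simp: scaleC_complex_def cinner_complex_def algebra_simps inner_complex_def
      scaleR_conv_of_real)
end


section \<open>The algebra of bounded operators on a complex Hilbert space\<close>

typedef (overloaded) 'a bounded_op =
  "{T :: 'a :: chilbert_space \<Rightarrow>\<^sub>L 'a. \<forall>c x. blinfun_apply T (c *\<^sub>C x) = c *\<^sub>C blinfun_apply T x}"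
  by (rule exI[of _ 0]) simp

lemma bounded_linear_scaleC_comp: "bounded_linear (\<lambda>x. c *\<^sub>C blinfun_apply T x)"
  for T :: "'a :: real_normed_vector \<Rightarrow>\<^sub>L 'b :: complex_inner"
proof (rule bounded_linear_intro[where K = "cmod c * norm T"])
  show "norm (c *\<^sub>C blinfun_apply T x) \<le> norm x * (cmod c * norm T)" for x
    using mult_left_mono[OF norm_blinfun[of T x], of "cmod c"]
    by (simp add: norm_scaleC mult_ac)
qed (simp_all add: blinfun.bilinear_simps scaleC_add_right scaleR_scaleC scaleC_scaleC mult.commute)

setup_lifting type_definition_bounded_op

lift_definition op_apply :: "'a :: chilbert_space bounded_op \<Rightarrow> 'a \<Rightarrow> 'a" is blinfun_apply .

lemma op_eqI: "(\<And>x. op_apply S x = op_apply T x) \<Longrightarrow> S = T"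
  by transfer (auto intro: blinfun_eqI)

instantiation bounded_op :: (chilbert_space) real_normed_vector
begin
lift_definition zero_bounded_op :: "'a bounded_op" is 0 by simp
lift_definition plus_bounded_op :: "'a bounded_op \<Rightarrow> 'a bounded_op \<Rightarrow> 'a bounded_op" is "(+)"
  by (simp add: blinfun.add_left scaleC_add_right)
lift_definition minus_bounded_op :: "'a bounded_op \<Rightarrow> 'a bounded_op \<Rightarrow> 'a bounded_op" is "(-)"
  by (simp add: blinfun.diff_left complex_vector.scale_right_diff_distrib)
lift_definition uminus_bounded_op :: "'a bounded_op \<Rightarrow> 'a bounded_op" is uminus
  by (simp add: blinfun.minus_left)
lift_definition scaleR_bounded_op :: "real \<Rightarrow> 'a bounded_op \<Rightarrow> 'a bounded_op" is scaleR
  by (simp add: blinfun.scaleR_left scaleR_scaleC scaleC_scaleC mult.commute)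
lift_definition norm_bounded_op :: "'a bounded_op \<Rightarrow> real" is norm .
definition dist_bounded_op :: "'a bounded_op \<Rightarrow> 'a bounded_op \<Rightarrow> real"
  where "dist_bounded_op S T = norm (S - T)"
definition sgn_bounded_op :: "'a bounded_op \<Rightarrow> 'a bounded_op"
  where "sgn_bounded_op T = scaleR (inverse (norm T)) T"
definition [code del]:
  "(uniformity :: ('a bounded_op \<times> 'a bounded_op) filter) =
    (INF e\<in>{0<..}. principal {(S, T). dist S T < e})"
definition open_bounded_op :: "'a bounded_op set \<Rightarrow> bool"
  where [code del]: "open_bounded_op U =
    (\<forall>S\<in>U. eventually (\<lambda>(S', T). S' = S \<longrightarrow> T \<in> U) uniformity)"
instance
  by standard
    (simp_all add: dist_bounded_op_def sgn_bounded_op_def uniformity_bounded_op_def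
       open_bounded_op_def,
     (transfer, simp add: algebra_simps norm_triangle_ineq)+)
end

instantiation bounded_op :: (chilbert_space) complex_vector
begin
lift_definition scaleC_bounded_op :: "complex \<Rightarrow> 'a bounded_op \<Rightarrow> 'a bounded_op"
  is "\<lambda>c T. Blinfun (\<lambda>x. c *\<^sub>C blinfun_apply T x)"
  by (simp add: bounded_linear_Blinfun_apply bounded_linear_scaleC_comp scaleC_scaleC mult.commute)
instance
proof
  fix a b :: complex and r :: real and S T :: "'a bounded_op"
  have scaleC: "op_apply (c *\<^sub>C R) x = c *\<^sub>C op_apply R x" for c x and R :: "'a bounded_op"
    by transfer (simp add: bounded_linear_Blinfun_apply bounded_linear_scaleC_comp)
  have plus: "op_apply (P + Q) x = op_apply P x + op_apply Q x" for x and P Q :: "'a bounded_op"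
    by transfer (simp add: blinfun.add_left)
  have scaleR: "op_apply (r *\<^sub>R T) x = r *\<^sub>R op_apply T x" for x
    by transfer (simp add: blinfun.scaleR_left)
  show "a *\<^sub>C (S + T) = a *\<^sub>C S + a *\<^sub>C T"
    by (rule op_eqI) (simp add: scaleC plus scaleC_add_right)
  show "(a + b) *\<^sub>C T = a *\<^sub>C T + b *\<^sub>C T"
    by (rule op_eqI) (simp add: scaleC plus scaleC_add_left)
  show "a *\<^sub>C b *\<^sub>C T = (a * b) *\<^sub>C T"
    by (rule op_eqI) (simp add: scaleC scaleC_scaleC)
  show "r *\<^sub>R T = complex_of_real r *\<^sub>C T"
    by (rule op_eqI) (simp only: scaleC scaleR scaleR_scaleC)
qed
end

instantiation bounded_op :: (chilbert_space) "{real_normed_algebra, monoid_mult}"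
begin
lift_definition one_bounded_op :: "'a bounded_op" is id_blinfun by simp
lift_definition times_bounded_op :: "'a bounded_op \<Rightarrow> 'a bounded_op \<Rightarrow> 'a bounded_op"
  is "(o\<^sub>L)" by simp
instance
  by standard
    (transfer; (rule norm_blinfun_compose)?; (rule blinfun_eqI)?; simp add: blinfun.bilinear_simps)+
end

lemma op_apply_simps [simp]:
  "op_apply 0 x = 0" "op_apply 1 x = x"
  "op_apply (S + T) x = op_apply S x + op_apply T x"
  "op_apply (S - T) x = op_apply S x - op_apply T x"
  "op_apply (- T) x = - op_apply T x"
  "op_apply (r *\<^sub>R T) x = r *\<^sub>R op_apply T x"
  "op_apply (c *\<^sub>C T) x = c *\<^sub>C op_apply T x"
  "op_apply (S * T) x = op_apply S (op_apply T x)"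
  by (transfer; simp add: blinfun.bilinear_simps bounded_linear_Blinfun_apply
      bounded_linear_scaleC_comp)+

lemma op_apply_linear:
  "op_apply T (x + y) = op_apply T x + op_apply T y"
  "op_apply T (c *\<^sub>C x) = c *\<^sub>C op_apply T x"
  by (transfer; simp add: blinfun.bilinear_simps)+

text \<open>
  The Loewner order: \<open>S \<le> T\<close> iff \<open>T - S\<close> is positive. The membership in \<open>\<real>\<^sub>\<ge>\<^sub>0\<close> says that the
  complex number is real and nonnegative. (The strict order \<open><\<close> of the type class is \<open>\<le>\<close>
  together with \<open>\<noteq>\<close>; it does not mean that the difference is positive and invertible.)
\<close>

definition positive_op :: "'a :: chilbert_space bounded_op \<Rightarrow> bool" where
  "positive_op T \<longleftrightarrow> (\<forall>x. cinner (op_apply T x) x \<in> \<real>\<^sub>\<ge>\<^sub>0)"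

lemma op_eq_0I:
  assumes "\<And>x. cinner (op_apply T x) x = 0"
  shows "T = 0"
proof (rule op_eqI)
  fix x
  let ?y = "op_apply T x"
  have sum0: "cinner (op_apply T u) v + cinner (op_apply T v) u = 0" for u v
    using assms[of "u + v"] assms[of u] assms[of v]
    by (simp add: op_apply_linear cinner_add_left cinner_add_right add.commute)
  have "- \<i> * cinner (op_apply T x) ?y + \<i> * cinner (op_apply T ?y) x = 0"
    using sum0[of x "\<i> *\<^sub>C ?y"]
    by (simp add: op_apply_linear cinner_scaleC_left cinner_scaleC_right)
  then have "cinner ?y ?y = 0"
    using sum0[of x ?y] by (simp add: algebra_simps)
  then show "op_apply T x = op_apply 0 x"
    by (simp add: cinner_self)
qed

lemma positive_op_0: "positive_op 0"
  by (simp add: positive_op_def cinner_0_left)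

lemma positive_op_add: "positive_op S \<Longrightarrow> positive_op T \<Longrightarrow> positive_op (S + T)"
  unfolding positive_op_def op_apply_simps cinner_add_left by (simp add: nonneg_Reals_add_I)

lemma positive_op_scaleR: "0 \<le> r \<Longrightarrow> positive_op T \<Longrightarrow> positive_op (r *\<^sub>R T)"
  unfolding positive_op_def scaleR_scaleC op_apply_simps cinner_scaleC_left
  by (simp add: nonneg_Reals_mult_I)

lemma positive_op_antisym:
  assumes "positive_op T" "positive_op (- T)"
  shows "T = 0"
proof (rule op_eq_0I)
  fix x
  have "cinner (op_apply T x) x \<in> \<real>\<^sub>\<ge>\<^sub>0" "- cinner (op_apply T x) x \<in> \<real>\<^sub>\<ge>\<^sub>0"
    using assms by (simp_all add: positive_op_def cinner_minus_left)
  then show "cinner (op_apply T x) x = 0"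
    by (auto simp: complex_nonneg_Reals_iff complex_eq_iff)
qed

instantiation bounded_op :: (chilbert_space) ordered_real_vector
begin
definition less_eq_bounded_op :: "'a bounded_op \<Rightarrow> 'a bounded_op \<Rightarrow> bool"
  where "S \<le> T \<longleftrightarrow> positive_op (T - S)"
definition less_bounded_op :: "'a bounded_op \<Rightarrow> 'a bounded_op \<Rightarrow> bool"
  where "S < T \<longleftrightarrow> S \<le> T \<and> \<not> T \<le> (S :: 'a bounded_op)"
instance
proof
  fix R S T U :: "'a bounded_op" and a b :: real
  show "S < T \<longleftrightarrow> S \<le> T \<and> \<not> T \<le> S" by (rule less_bounded_op_def)
  show "S \<le> S" by (simp add: less_eq_bounded_op_def positive_op_0)
  show "R \<le> S \<Longrightarrow> S \<le> T \<Longrightarrow> R \<le> T"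
    using positive_op_add[of "S - R" "T - S"] by (simp add: less_eq_bounded_op_def)
  show "S \<le> T \<Longrightarrow> T \<le> S \<Longrightarrow> S = T"
    using positive_op_antisym[of "T - S"] by (simp add: less_eq_bounded_op_def)
  show "S \<le> T \<Longrightarrow> R + S \<le> R + T" by (simp add: less_eq_bounded_op_def)
  show "S \<le> T \<Longrightarrow> 0 \<le> a \<Longrightarrow> a *\<^sub>R S \<le> a *\<^sub>R T"
    using positive_op_scaleR[of a "T - S"]
    by (simp add: less_eq_bounded_op_def scaleR_right_diff_distrib)
  show "a \<le> b \<Longrightarrow> 0 \<le> S \<Longrightarrow> a *\<^sub>R S \<le> b *\<^sub>R S"
    using positive_op_scaleR[of "b - a" S]
    by (simp add: less_eq_bounded_op_def scaleR_left_diff_distrib)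
qed
end

definition positive_map ::
  "('a :: chilbert_space bounded_op \<Rightarrow> 'b :: chilbert_space bounded_op) \<Rightarrow> bool" where
  "positive_map \<Phi> \<longleftrightarrow> (\<forall>T. 0 \<le> T \<longrightarrow> 0 \<le> \<Phi> T)"


section \<open>Continuous functional calculus\<close>

definition invertible_op :: "'a :: chilbert_space bounded_op \<Rightarrow> bool" where
  "invertible_op T \<longleftrightarrow> (\<exists>S. S * T = 1 \<and> T * S = 1)"

definition op_spectrum :: "'a :: chilbert_space bounded_op \<Rightarrow> complex set" where
  "op_spectrum T = {z. \<not> invertible_op (T - z *\<^sub>C 1)}"

definition poly_op :: "real poly \<Rightarrow> 'a :: chilbert_space bounded_op \<Rightarrow> 'a bounded_op" where
  "poly_op p T = (\<Sum>i\<le>degree p. coeff p i *\<^sub>R T ^ i)"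

text \<open>
  For a self-adjoint operator \<open>T\<close> and a real function \<open>f\<close> that is continuous on the spectrum of
  \<open>T\<close> (which is then a compact set of real numbers), \<open>f(T)\<close> is the norm limit of \<open>p\<^sub>n(T)\<close> for any
  real polynomials \<open>p\<^sub>n\<close> converging to \<open>f\<close> uniformly on the spectrum. Outside this situation
  the value of \<open>cfc\<close> is not meaningful.
\<close>

definition cfc :: "(real \<Rightarrow> real) \<Rightarrow> 'a :: chilbert_space bounded_op \<Rightarrow> 'a bounded_op" where
  "cfc f T = (THE S. \<forall>p :: nat \<Rightarrow> real poly.
     uniform_limit {t. complex_of_real t \<in> op_spectrum T} (\<lambda>n. poly (p n)) f sequentially \<longrightarrow>
     (\<lambda>n. poly_op (p n) T) \<longlonglongrightarrow> S)"

definition op_powr :: "'a :: chilbert_space bounded_op \<Rightarrow> real \<Rightarrow> 'a bounded_op" where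
  "op_powr T q = cfc (\<lambda>t. t powr q) T"

end

theory Submission
  imports Defs "HOL-Computational_Algebra.Fundamental_Theorem_Algebra"
begin

text \<open>
  Put \<open>S = M + m\<close>, \<open>B = \<Phi>(A)\<close>, \<open>X = \<Phi>(g(A))\<close>. By convexity \<open>g\<close> lies below its chord, so
  \<open>M m X + B \<le> S\<close>. For \<open>r = p/2 \<ge> 1\<close>, the operators \<open>A\<^sub>1 = (M m X / S)\<^sup>r\<close> and \<open>B\<^sub>1 = (B / S)\<^sup>r\<close> still
  satisfy \<open>A\<^sub>1 + B\<^sub>1 \<le> 1\<close>, because \<open>u\<^sup>r \<le> u\<close> on \<open>[0, 1]\<close>. Positive operators with \<open>A\<^sub>1 + B\<^sub>1 \<le> 1\<close> have
  \<open>\<parallel>A\<^sub>1 B\<^sub>1\<parallel> \<le> 1/4\<close>: positivity of \<open>\<langle>A\<^sub>1(y - w), y - w\<rangle> + \<langle>B\<^sub>1(x - w), x - w\<rangle>\<close> at \<open>w = A\<^sub>1 y + B\<^sub>1 x\<close> gives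
  \<open>\<parallel>A\<^sub>1 y + B\<^sub>1 x\<parallel>\<^sup>2 \<le> \<langle>A\<^sub>1 y, y\<rangle> + \<langle>B\<^sub>1 x, x\<rangle>\<close>, while \<open>A\<^sub>1 - A\<^sub>1\<^sup>2 \<le> 1/4\<close> and \<open>B\<^sub>1 - B\<^sub>1\<^sup>2 \<le> 1/4\<close>. Hence
  \<open>A\<^sub>1\<^sup>2 \<le> B\<^sub>1\<^sup>-\<^sup>2 / 16\<close>, which is the claim.
\<close>

section \<open>Bounded operators\<close>

lemma norm_op_apply: "norm (op_apply T x) \<le> norm T * norm x"
  by transfer (rule norm_blinfun)

lemma norm_op_bound: "0 \<le> b \<Longrightarrow> (\<And>x. norm (op_apply T x) \<le> b * norm x) \<Longrightarrow> norm T \<le> b"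
  by transfer (rule norm_blinfun_bound)

lemma op_apply_real_linear [simp]:
  "op_apply T 0 = 0"
  "op_apply T (x + y) = op_apply T x + op_apply T y"
  "op_apply T (x - y) = op_apply T x - op_apply T y"
  "op_apply T (r *\<^sub>R x) = r *\<^sub>R op_apply T x"
  by (transfer; simp add: blinfun.bilinear_simps)+

lemma mult_scaleC_left_op: "(c *\<^sub>C S) * T = c *\<^sub>C (S * T)"
  for S T :: "'a :: chilbert_space bounded_op"
  by (rule op_eqI) simp

lemma mult_scaleC_right_op: "S * (c *\<^sub>C T) = c *\<^sub>C (S * T)"
  for S T :: "'a :: chilbert_space bounded_op"
  by (rule op_eqI) (simp add: op_apply_linear)

section \<open>Completeness of the operator algebra\<close>

instance chilbert_space \<subseteq> banach ..

text \<open>The embedding into the real bounded linear maps is isometric, and commuting with complex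
  scalars survives pointwise limits, so completeness is inherited.\<close>

instance bounded_op :: (chilbert_space) banach
proof
  fix X :: "nat \<Rightarrow> 'a bounded_op"
  assume "Cauchy X"
  have dist: "dist (Rep_bounded_op S) (Rep_bounded_op T) = dist S T" for S T :: "'a bounded_op"
    by (simp add: dist_bounded_op_def dist_norm norm_bounded_op.rep_eq minus_bounded_op.rep_eq)
  have "Cauchy (\<lambda>n. Rep_bounded_op (X n))"
    using \<open>Cauchy X\<close> by (simp add: Cauchy_def dist)
  then obtain L where L: "(\<lambda>n. Rep_bounded_op (X n)) \<longlonglongrightarrow> L"
    by (metis Cauchy_convergent convergent_def)
  have lim: "(\<lambda>n. blinfun_apply (Rep_bounded_op (X n)) x) \<longlonglongrightarrow> blinfun_apply L x" for x
    by (intro blinfun.tendsto L tendsto_const)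
  have "blinfun_apply L (c *\<^sub>C x) = c *\<^sub>C blinfun_apply L x" for c x
  proof (rule LIMSEQ_unique[OF lim])
    have "bounded_linear (\<lambda>x :: 'a. c *\<^sub>C x)"
      using bounded_linear_scaleC_comp[of c id_blinfun] by simp
    from bounded_linear.tendsto[OF this lim]
    have "(\<lambda>n. c *\<^sub>C blinfun_apply (Rep_bounded_op (X n)) x) \<longlonglongrightarrow> c *\<^sub>C blinfun_apply L x" .
    moreover have "blinfun_apply (Rep_bounded_op (X n)) (c *\<^sub>C x)
        = c *\<^sub>C blinfun_apply (Rep_bounded_op (X n)) x" for n
      using Rep_bounded_op[of "X n"] by simp
    ultimately show "(\<lambda>n. blinfun_apply (Rep_bounded_op (X n)) (c *\<^sub>C x)) \<longlonglongrightarrow> c *\<^sub>C blinfun_apply L x"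
      by simp
  qed
  then have "Rep_bounded_op (Abs_bounded_op L) = L"
    by (intro Abs_bounded_op_inverse) simp
  then have "X \<longlonglongrightarrow> Abs_bounded_op L"
    using L by (simp add: LIMSEQ_def flip: dist)
  then show "convergent X"
    by (auto simp: convergent_def)
qed

lemma norm_op_power: "norm (T ^ n) \<le> norm T ^ n" for T :: "'a :: chilbert_space bounded_op"
proof (induction n)
  case 0
  \<comment> \<open>Only \<open>norm 1 \<le> 1\<close> holds in general: on the trivial space
    \<open>1 = 0\<close>.\<close>
  show ?case by (auto intro: norm_op_bound)
next
  case (Suc n)
  then show ?case
    using norm_mult_ineq[of T "T ^ n"] mult_left_mono[OF Suc, of "norm T"] by simp
qed

text \<open>The Neumann series is a two-sided inverse: splitting off its first term gives
  \<open>?S = 1 + E * ?S\<close> and \<open>?S = 1 + ?S * E\<close>.\<close>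

lemma Neumann_invertible:
  fixes E :: "'a :: chilbert_space bounded_op"
  assumes "norm E < 1"
  shows "invertible_op (1 - E)"
proof -
  have summ: "summable (\<lambda>n. E ^ n)"
    by (rule summable_comparison_test'[of "\<lambda>n. norm E ^ n" 0])
      (use assms norm_op_power in \<open>auto intro: summable_geometric\<close>)
  let ?S = "\<Sum>n. E ^ n"
  have "?S = 1 + (\<Sum>n. E ^ Suc n)"
    using suminf_split_head[OF summ] by simp
  moreover have "(\<Sum>n. E ^ Suc n) = E * ?S"
    using bounded_linear.suminf[OF bounded_linear_mult_right summ, of E] by simp
  moreover have "(\<Sum>n. E ^ Suc n) = ?S * E"
    using bounded_linear.suminf[OF bounded_linear_mult_left summ, of E] by (simp add: power_commutes)
  ultimately have "?S * (1 - E) = 1" "(1 - E) * ?S = 1"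
    by (simp_all add: algebra_simps)
  then show ?thesis
    by (auto simp: invertible_op_def)
qed

lemma invertible_op_mult:
  assumes "invertible_op S" "invertible_op T"
  shows "invertible_op (S * T)"
proof -
  obtain S' where S: "S' * S = 1" "S * S' = 1"
    using assms(1) unfolding invertible_op_def by blast
  obtain T' where T: "T' * T = 1" "T * T' = 1"
    using assms(2) unfolding invertible_op_def by blast
  have "(T' * S') * (S * T) = T' * (S' * S) * T" "(S * T) * (T' * S') = S * (T * T') * S'"
    by (rule op_eqI; simp)+
  then have "(T' * S') * (S * T) = 1" "(S * T) * (T' * S') = 1"
    by (simp_all only: S T mult_1_right)
  then show ?thesis
    unfolding invertible_op_def by blast
qed

lemma invertible_op_scaleC:
  assumes "c \<noteq> 0" "invertible_op (c *\<^sub>C T)"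
  shows "invertible_op T"
proof -
  obtain S where "S * (c *\<^sub>C T) = 1" "(c *\<^sub>C T) * S = 1"
    using assms by (auto simp: invertible_op_def)
  then have "(c *\<^sub>C S) * T = 1" "T * (c *\<^sub>C S) = 1"
    by (simp_all add: mult_scaleC_left_op mult_scaleC_right_op)
  then show ?thesis
    by (auto simp: invertible_op_def)
qed

lemma invertible_op_one: "invertible_op 1"
  by (auto simp: invertible_op_def intro: exI[of _ 1])

text \<open>Lax-Milgram argument: for large \<open>K\<close> the operator
  \<open>E = 1 - (1 / K) *\<^sub>R P\<close> is a strict contraction, so the Neumann series inverts
  \<open>1 - E\<close>. Symmetry of \<open>P\<close> is not assumed, because \<open>P\<close> will
  be a complex multiple of \<open>T - z\<close>.\<close>

lemma coercive_invertible:
  assumes "0 < c" and coercive: "\<And>x. c * (norm x)\<^sup>2 \<le> inner (op_apply P x) x"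
  shows "invertible_op P"
proof -
  define N where "N = norm P"
  \<comment> \<open>\<open>N\<^sup>2 \<le> c * K\<close> lets the quadratic term of
    \<open>(norm (op_apply E x))\<^sup>2\<close> consume at most half of the gain
    \<open>2 * c / K\<close>. The summand \<open>c\<close> makes \<open>K\<close> positive and keeps
    \<open>1 - c / K\<close> nonnegative.\<close>
  define K where "K = N\<^sup>2 / c + c"
  have K: "0 < K" "c \<le> K" "N\<^sup>2 \<le> c * K"
    using \<open>0 < c\<close> by (simp_all add: K_def add_nonneg_pos field_simps power2_eq_square)
  define E where "E = 1 - (1 / K) *\<^sub>R P"
  have "norm (op_apply E x) \<le> sqrt (1 - c / K) * norm x" for x
  proof -
    have "(norm (op_apply P x))\<^sup>2 \<le> N\<^sup>2 * (norm x)\<^sup>2"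
      using power_mono[OF norm_op_apply[of P x], of 2] by (simp add: N_def power_mult_distrib)
    also have "\<dots> \<le> c * K * (norm x)\<^sup>2"
      using K by (intro mult_right_mono) auto
    finally have "(norm (op_apply P x))\<^sup>2 / K\<^sup>2 \<le> c / K * (norm x)\<^sup>2"
      using K by (simp add: field_simps power2_eq_square)
    moreover have "c / K * (norm x)\<^sup>2 \<le> inner (op_apply P x) x / K"
      using divide_right_mono[OF coercive[of x], of K] K by simp
    moreover have "(norm (op_apply E x))\<^sup>2 =
        (norm x)\<^sup>2 - 2 * (inner (op_apply P x) x / K) + (norm (op_apply P x))\<^sup>2 / K\<^sup>2"
      unfolding power2_norm_eq_inner E_def
      by (simp add: inner_diff_left inner_diff_right inner_commute power2_eq_square)
    ultimately have "(norm (op_apply E x))\<^sup>2 \<le> (1 - c / K) * (norm x)\<^sup>2"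
      unfolding left_diff_distrib by linarith
    then have "sqrt ((norm (op_apply E x))\<^sup>2) \<le> sqrt ((1 - c / K) * (norm x)\<^sup>2)"
      by (rule real_sqrt_le_mono)
    then show ?thesis
      by (simp add: real_sqrt_mult)
  qed
  then have "norm E \<le> sqrt (1 - c / K)"
    using K by (intro norm_op_bound) simp_all
  also have "\<dots> < 1"
    using K \<open>0 < c\<close> by simp
  finally have "invertible_op (1 - E)"
    by (rule Neumann_invertible)
  then have "invertible_op (complex_of_real (1 / K) *\<^sub>C P)"
    unfolding scaleR_scaleC[symmetric] by (simp add: E_def)
  then show ?thesis
    by (rule invertible_op_scaleC[rotated]) (use K in simp)
qed


section \<open>Self-adjoint operators\<close>

text \<open>For complex linear operators, symmetry with respect to the real part of the inner product
  already implies symmetry with respect to the complex inner product.\<close>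

definition selfadj_op :: "'a :: chilbert_space bounded_op \<Rightarrow> bool" where
  "selfadj_op T \<longleftrightarrow> (\<forall>x y. inner (op_apply T x) y = inner x (op_apply T y))"

lemma inner_scaleC_i_left: "inner (\<i> *\<^sub>C x) y = - Im (cinner x y)"
  for x y :: "'a :: complex_inner"
  by (simp add: inner_eq_Re_cinner cinner_scaleC_left)

lemma inner_scaleC_i_right: "inner x (\<i> *\<^sub>C y) = Im (cinner x y)"
  for x y :: "'a :: complex_inner"
  by (simp add: inner_eq_Re_cinner cinner_scaleC_right)

lemma selfadj_cinner_real:
  assumes "selfadj_op T"
  shows "cinner (op_apply T x) x = complex_of_real (inner (op_apply T x) x)"
proof -
  have "inner (op_apply T (\<i> *\<^sub>C x)) x = inner (\<i> *\<^sub>C x) (op_apply T x)"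
    using assms by (simp add: selfadj_op_def)
  also have "\<dots> = inner (op_apply T x) (\<i> *\<^sub>C x)"
    by (rule inner_commute)
  finally have "Im (cinner (op_apply T x) x) = 0"
    by (simp add: op_apply_linear inner_scaleC_i_left inner_scaleC_i_right)
  then show ?thesis
    by (simp add: complex_eq_iff inner_eq_Re_cinner)
qed

text \<open>Reduces the Loewner order to the real inner product. Symmetry comes from polarizing the
  vanishing imaginary part of the quadratic form and then replacing \<open>y\<close> by
  \<open>\<i> *\<^sub>C y\<close>.\<close>

lemma positive_op_iff: "positive_op T \<longleftrightarrow> selfadj_op T \<and> (\<forall>x. 0 \<le> inner (op_apply T x) x)"
proof
  assume pos: "positive_op T"
  have zero: "inner (\<i> *\<^sub>C op_apply T x) x = 0" for x
    using pos by (simp add: positive_op_def complex_nonneg_Reals_iff inner_scaleC_i_left)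
  have anti: "inner (\<i> *\<^sub>C op_apply T x) y + inner (\<i> *\<^sub>C op_apply T y) x = 0" for x y
    using zero[of "x + y"] zero[of x] zero[of y]
    by (simp add: scaleC_add_right inner_add_left inner_add_right)
  have "inner (op_apply T x) y = inner x (op_apply T y)" for x y
    using anti[of x "\<i> *\<^sub>C y"]
    by (simp add: op_apply_linear scaleC_scaleC inner_scaleC_i_left cinner_scaleC_right
        complex_vector.scale_minus_left scaleC_one inner_eq_Re_cinner[symmetric] inner_commute)
  then show "selfadj_op T \<and> (\<forall>x. 0 \<le> inner (op_apply T x) x)"
    using pos
    by (simp add: selfadj_op_def positive_op_def complex_nonneg_Reals_iff inner_eq_Re_cinner)
next
  assume "selfadj_op T \<and> (\<forall>x. 0 \<le> inner (op_apply T x) x)"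
  then show "positive_op T"
    by (simp add: positive_op_def selfadj_cinner_real)
qed

lemma selfadj_op_algebra:
  "selfadj_op 1"
  "selfadj_op S \<Longrightarrow> selfadj_op T \<Longrightarrow> selfadj_op (S + T)"
  "selfadj_op S \<Longrightarrow> selfadj_op T \<Longrightarrow> selfadj_op (S - T)"
  "selfadj_op T \<Longrightarrow> selfadj_op (r *\<^sub>R T)"
  "selfadj_op S \<Longrightarrow> selfadj_op T \<Longrightarrow> S * T = T * S \<Longrightarrow> selfadj_op (S * T)"
proof -
  assume *: "selfadj_op S" "selfadj_op T" "S * T = T * S"
  have "op_apply S (op_apply T x) = op_apply T (op_apply S x)" for x
    using arg_cong[OF *(3), of "\<lambda>R. op_apply R x"] by simp
  then show "selfadj_op (S * T)"
    using * by (simp add: selfadj_op_def)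
qed (auto simp: selfadj_op_def inner_add_left inner_add_right inner_diff_left inner_diff_right)

lemma less_eq_op_iff:
  "S \<le> T \<longleftrightarrow> selfadj_op (T - S) \<and> (\<forall>x. inner (op_apply S x) x \<le> inner (op_apply T x) x)"
  by (simp add: less_eq_bounded_op_def positive_op_iff inner_diff_left)

lemma selfadj_op_lower:
  assumes "a *\<^sub>R 1 \<le> T"
  shows "selfadj_op T"
proof -
  have "selfadj_op (T - a *\<^sub>R 1)"
    using assms unfolding less_eq_op_iff by blast
  from selfadj_op_algebra(2)[OF this selfadj_op_algebra(4)[OF selfadj_op_algebra(1)], of a]
  show ?thesis by simp
qed

text \<open>Numerical range argument: for \<open>z\<close> off the interval, a suitable factor
  \<open>w\<close> makes the real part of the form of \<open>w *\<^sub>C (T - z *\<^sub>C 1)\<close>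
  uniformly positive, and coercivity gives invertibility.\<close>

lemma op_spectrum_selfadj:
  assumes T: "a *\<^sub>R 1 \<le> T" "T \<le> b *\<^sub>R 1" and z: "z \<in> op_spectrum T"
  shows "Im z = 0" "Re z \<in> {a..b}"
proof -
  have sa: "selfadj_op T"
    using T(1) by (rule selfadj_op_lower)
  have invI: "invertible_op (T - z *\<^sub>C 1)"
    if w: "w \<noteq> 0" "0 < c"
      "\<And>x. c * (norm x)\<^sup>2 \<le> Re (w * (complex_of_real (inner (op_apply T x) x) - z * (norm x)\<^sup>2))"
    for w c
  proof (rule invertible_op_scaleC[OF \<open>w \<noteq> 0\<close>], rule coercive_invertible[OF \<open>0 < c\<close>])
    fix x
    have "cinner (op_apply (w *\<^sub>C (T - z *\<^sub>C 1)) x) x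
        = w * (complex_of_real (inner (op_apply T x) x) - z * (norm x)\<^sup>2)"
      using cinner_add_left[of "op_apply T x" "- (z *\<^sub>C x)" x]
      by (simp add: cinner_scaleC_left cinner_minus_left selfadj_cinner_real[OF sa] cinner_self)
    then show "c * (norm x)\<^sup>2 \<le> inner (op_apply (w *\<^sub>C (T - z *\<^sub>C 1)) x) x"
      using w(3) by (simp add: inner_eq_Re_cinner)
  qed
  have T': "a * (norm x)\<^sup>2 \<le> inner (op_apply T x) x" "inner (op_apply T x) x \<le> b * (norm x)\<^sup>2" for x
    using T by (simp_all add: less_eq_op_iff power2_norm_eq_inner)
  have ninv: "\<not> invertible_op (T - z *\<^sub>C 1)"
    using z by (simp add: op_spectrum_def)
  show "Im z = 0"
  proof (rule ccontr)
    assume "Im z \<noteq> 0"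
    then have "invertible_op (T - z *\<^sub>C 1)"
      \<comment> \<open>The factor \<open>\<i>\<close> makes the real form of \<open>T\<close>
        imaginary, so the real part left over is exactly
        \<open>\<bar>Im z\<bar> * (norm x)\<^sup>2\<close>.\<close>
      by (intro invI[of "\<i> * complex_of_real (sgn (Im z))" "\<bar>Im z\<bar>"])
        (auto simp: sgn_if abs_if)
    with ninv show False by blast
  qed
  show "Re z \<in> {a..b}"
  proof (rule ccontr)
    assume "Re z \<notin> {a..b}"
    then consider "Re z < a" | "b < Re z" by force
    then have "invertible_op (T - z *\<^sub>C 1)"
    proof cases
      case 1
      then show ?thesis
        using T'(1) by (intro invI[of 1 "a - Re z"]) (auto simp: algebra_simps)
    next
      case 2
      then show ?thesis
        using T'(2) by (intro invI[of "- 1" "Re z - b"]) (auto simp: algebra_simps)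
    qed
    with ninv show False by blast
  qed
qed


section \<open>Polynomials of operators\<close>

lemma poly_op_0 [simp]: "poly_op 0 T = 0"
  by (simp add: poly_op_def)

text \<open>Horner recursion, which opens the way to induction over \<open>pCons\<close>. The case
  \<open>p = 0\<close> is separate because there the degree does not grow.\<close>

lemma poly_op_pCons [simp]: "poly_op (pCons a p) T = a *\<^sub>R 1 + T * poly_op p T"
proof (cases "p = 0")
  case False
  then show ?thesis
    by (simp add: poly_op_def sum.atMost_Suc_shift sum_distrib_left mult_scaleR_right
        del: sum.atMost_Suc)
qed (simp add: poly_op_def)

lemma poly_op_add: "poly_op (p + q) T = poly_op p T + poly_op q T"
  by (induction p q rule: poly_induct2) (simp_all add: algebra_simps)

lemma poly_op_smult: "poly_op (smult c p) T = c *\<^sub>R poly_op p T"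
  by (induction p) (simp_all add: algebra_simps)

lemma poly_op_diff: "poly_op (p - q) T = poly_op p T - poly_op q T"
  using poly_op_add[of "p - q" q T] by simp

lemma poly_op_mult: "poly_op (p * q) T = poly_op p T * poly_op q T"
  by (induction p) (simp_all add: poly_op_add poly_op_smult algebra_simps)

lemma selfadj_poly_op:
  assumes "selfadj_op T"
  shows "selfadj_op (poly_op p T)"
proof (induction p)
  case 0
  show ?case by (simp add: selfadj_op_def)
next
  case (pCons a p)
  \<comment> \<open>\<open>T\<close> is itself the polynomial \<open>[:0, 1:]\<close> of
    \<open>T\<close>, so commutation is inherited from polynomials.\<close>
  have "T * poly_op p T = poly_op p T * T"
    using poly_op_mult[of "[:0, 1:]" p T] poly_op_mult[of p "[:0, 1:]" T]
    by (simp add: mult.commute)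
  then show ?case
    using pCons assms by (auto intro!: selfadj_op_algebra)
qed

text \<open>Complex coefficients are needed to split a polynomial into linear factors; the fold
  provides the Horner recursion at once.\<close>

definition cpoly_op :: "complex poly \<Rightarrow> 'a :: chilbert_space bounded_op \<Rightarrow> 'a bounded_op" where
  "cpoly_op p T = fold_coeffs (\<lambda>a S. a *\<^sub>C 1 + T * S) p 0"

lemma cpoly_op_0 [simp]: "cpoly_op 0 T = 0"
  by (simp add: cpoly_op_def)

lemma cpoly_op_pCons [simp]: "cpoly_op (pCons a p) T = a *\<^sub>C 1 + T * cpoly_op p T"
  by (cases "p = 0 \<and> a = 0") (auto simp: cpoly_op_def)

lemma cpoly_op_add: "cpoly_op (p + q) T = cpoly_op p T + cpoly_op q T"
  by (induction p q rule: poly_induct2) (simp_all add: algebra_simps scaleC_add_left)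

lemma cpoly_op_smult: "cpoly_op (smult c p) T = c *\<^sub>C cpoly_op p T"
  by (induction p) (simp_all add: scaleC_add_right scaleC_scaleC mult_scaleC_right_op)

lemma cpoly_op_of_real: "cpoly_op (map_poly complex_of_real p) T = poly_op p T"
  by (induction p) (simp_all add: map_poly_pCons scaleR_scaleC)

text \<open>One half of the spectral mapping theorem: \<open>p\<close> splits into linear factors,
  and each factor \<open>T - z *\<^sub>C 1\<close> is invertible since its root \<open>z\<close> is
  outside the spectrum.\<close>

lemma invertible_cpoly_op:
  assumes "p \<noteq> 0" and "\<And>z. z \<in> op_spectrum T \<Longrightarrow> poly p z \<noteq> 0"
  shows "invertible_op (cpoly_op p T)"
  using assms
proof (induction "degree p" arbitrary: p)
  case 0
  then obtain c where c: "p = [:c:]" "c \<noteq> 0"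
    by (metis degree_eq_zeroE pCons_0_0)
  then have "invertible_op (inverse c *\<^sub>C c *\<^sub>C (1 :: 'a bounded_op))"
    by (simp add: scaleC_scaleC scaleC_one invertible_op_one)
  with c show ?case
    by (auto intro: invertible_op_scaleC[of "inverse c"])
next
  case (Suc n)
  then obtain z where z: "poly p z = 0"
    using fundamental_theorem_of_algebra[of p] constant_degree[of p] by auto
  then obtain q where q: "p = [:- z, 1:] * q"
    by (auto simp: poly_eq_0_iff_dvd elim: dvdE)
  with Suc have "q \<noteq> 0" by auto
  with q Suc have "n = degree q"
    using degree_mult_eq[of "[:- z, 1:]" q] by simp
  then have "invertible_op (cpoly_op q T)"
    using \<open>q \<noteq> 0\<close> Suc(4) q by (intro Suc(1)) auto
  moreover have "invertible_op (T - z *\<^sub>C 1)"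
    using Suc(4) z by (auto simp: op_spectrum_def)
  moreover have "p = pCons 0 q + smult (- z) q"
    by (simp add: q)
  then have "cpoly_op p T = (T - z *\<^sub>C 1) * cpoly_op q T"
    by (simp only: cpoly_op_pCons cpoly_op_add cpoly_op_smult)
      (simp add: left_diff_distrib mult_scaleC_left_op)
  ultimately show ?case
    by (simp add: invertible_op_mult)
qed

text \<open>Let \<open>s = norm S\<close> and \<open>P = s\<^sup>2 - S * S\<close>. Symmetry bounds
  \<open>(norm (op_apply P x))\<^sup>2\<close> by \<open>s\<^sup>2\<close> times the defect
  \<open>s\<^sup>2 * (norm x)\<^sup>2 - (norm (op_apply S x))\<^sup>2\<close>. A left inverse of
  \<open>P\<close> would keep this defect away from zero on unit vectors, forcing the norm of
  \<open>S\<close> strictly below \<open>s\<close>.\<close>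

lemma selfadj_norm_not_invertible:
  assumes sa: "selfadj_op S" and pos: "0 < norm S"
  shows "\<not> invertible_op ((norm S)\<^sup>2 *\<^sub>R 1 - S * S)"
proof
  define s where "s = norm S"
  define P where "P = s\<^sup>2 *\<^sub>R 1 - S * S"
  assume "invertible_op ((norm S)\<^sup>2 *\<^sub>R 1 - S * S)"
  then obtain R where R: "R * P = 1"
    by (auto simp: invertible_op_def P_def s_def)
  \<comment> \<open>\<open>K\<close> bounds \<open>(norm R)\<^sup>2\<close>; the \<open>1\<close>
    makes it positive, and \<open>1 / s ^ 4\<close> ensures \<open>0 \<le> d\<close>, so that
    \<open>sqrt d\<close> can serve as a norm bound.\<close>
  define K where "K = (norm R)\<^sup>2 + 1 + 1 / s ^ 4"
  have s: "0 < s" using pos by (simp add: s_def)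
  then have K: "0 < K" "(norm R)\<^sup>2 \<le> K" "1 / s ^ 4 \<le> K"
    by (simp_all add: K_def add_nonneg_pos add_pos_nonneg)
  define d where "d = s\<^sup>2 - 1 / (K * s\<^sup>2)"
  have d0: "0 \<le> d"
    using K s by (simp add: d_def field_simps power2_eq_square power4_eq_xxxx)
  have "norm (op_apply S x) \<le> sqrt d * norm x" for x
  proof -
    have "(norm (op_apply P x))\<^sup>2 =
        s ^ 4 * (norm x)\<^sup>2 - 2 * s\<^sup>2 * (norm (op_apply S x))\<^sup>2 + (norm (op_apply S (op_apply S x)))\<^sup>2"
      using sa unfolding power2_norm_eq_inner P_def selfadj_op_def
      by (simp add: inner_diff_left inner_diff_right inner_commute power2_eq_square
          power4_eq_xxxx algebra_simps)
    also have "(norm (op_apply S (op_apply S x)))\<^sup>2 \<le> s\<^sup>2 * (norm (op_apply S x))\<^sup>2"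
      using power_mono[OF norm_op_apply[of S "op_apply S x"], of 2]
      by (simp add: s_def power_mult_distrib)
    finally have P: "(norm (op_apply P x))\<^sup>2 \<le> s\<^sup>2 * (s\<^sup>2 * (norm x)\<^sup>2 - (norm (op_apply S x))\<^sup>2)"
      by (simp add: algebra_simps power4_eq_xxxx power2_eq_square)
    have "x = op_apply R (op_apply P x)"
      using arg_cong[OF R, of "\<lambda>T. op_apply T x"] by simp
    then have "(norm x)\<^sup>2 \<le> (norm R)\<^sup>2 * (norm (op_apply P x))\<^sup>2"
      using power_mono[OF norm_op_apply[of R "op_apply P x"], of 2]
      by (simp add: power_mult_distrib)
    also have "\<dots> \<le> K * (norm (op_apply P x))\<^sup>2"
      using K by (intro mult_right_mono) auto
    also have "\<dots> \<le> K * (s\<^sup>2 * (s\<^sup>2 * (norm x)\<^sup>2 - (norm (op_apply S x))\<^sup>2))"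
      using K P by (intro mult_left_mono) auto
    finally have "(norm (op_apply S x))\<^sup>2 \<le> d * (norm x)\<^sup>2"
      using K s by (simp add: d_def field_simps)
    then have "sqrt ((norm (op_apply S x))\<^sup>2) \<le> sqrt (d * (norm x)\<^sup>2)"
      by (rule real_sqrt_le_mono)
    then show ?thesis
      by (simp add: real_sqrt_mult)
  qed
  then have "s \<le> sqrt d"
    unfolding s_def using d0 by (intro norm_op_bound) simp_all
  then have "s\<^sup>2 \<le> d"
    using s d0 by (metis less_eq_real_def power_mono real_sqrt_pow2)
  moreover have "0 < 1 / (K * s\<^sup>2)"
    using K s by simp
  ultimately show False
    by (simp add: d_def)
qed

text \<open>The operator \<open>\<parallel>p(T)\<parallel>\<^sup>2 - p(T)\<^sup>2\<close> is not invertible, so the complex polynomial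
  \<open>\<parallel>p(T)\<parallel>\<^sup>2 - p\<^sup>2\<close> has a root in the spectrum.\<close>

lemma norm_poly_op_attained_nonconst:
  assumes T: "a *\<^sub>R 1 \<le> T" "T \<le> b *\<^sub>R 1" and pos: "0 < norm (poly_op p T)"
    and nonconst: "p * p \<noteq> [:(norm (poly_op p T))\<^sup>2:]"
  shows "\<exists>t. complex_of_real t \<in> op_spectrum T \<and> \<bar>poly p t\<bar> = norm (poly_op p T)"
proof -
  define s where "s = norm (poly_op p T)"
  define q where "q = [:s\<^sup>2:] - p * p"
  have "poly_op q T = s\<^sup>2 *\<^sub>R 1 - poly_op p T * poly_op p T"
    by (simp add: q_def poly_op_diff poly_op_mult)
  then have ninv: "\<not> invertible_op (cpoly_op (map_poly complex_of_real q) T)"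
    using selfadj_norm_not_invertible[OF selfadj_poly_op[OF selfadj_op_lower[OF T(1)]] pos]
    by (simp add: cpoly_op_of_real s_def)
  have poly_real: "poly (map_poly complex_of_real r) (complex_of_real t) = complex_of_real (poly r t)"
    for r t by (induction r) (simp_all add: map_poly_pCons)
  have "q \<noteq> 0"
    using nonconst by (simp add: q_def s_def)
  then have "map_poly complex_of_real q \<noteq> 0"
    by (simp add: map_poly_eq_0_iff)
  then obtain z where z: "z \<in> op_spectrum T" "poly (map_poly complex_of_real q) z = 0"
    using invertible_cpoly_op[of "map_poly complex_of_real q" T] ninv by auto
  have "z = complex_of_real (Re z)"
    using op_spectrum_selfadj(1)[OF T z(1)] by (simp add: complex_eq_iff)
  then have "complex_of_real (Re z) \<in> op_spectrum T" "poly q (Re z) = 0"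
    using z poly_real[of q "Re z"] by simp_all
  moreover from this have "\<bar>poly p (Re z)\<bar> = s"
    by (simp add: q_def s_def abs_eq_iff flip: power2_eq_square)
      (metis abs_norm_cancel power2_eq_iff abs_eq_iff)
  ultimately show ?thesis
    unfolding s_def by blast
qed

text \<open>The square of \<open>[:c, 1:]\<close> is never constant, so its norm is attained at a
  spectral point once the operator is nonzero. \<open>T\<close> and \<open>T + 1\<close> cannot both
  vanish.\<close>

lemma op_spectrum_nonempty:
  fixes T :: "'a :: chilbert_space bounded_op"
  assumes T: "a *\<^sub>R 1 \<le> T" "T \<le> b *\<^sub>R 1" and nontriv: "(1 :: 'a bounded_op) \<noteq> 0"
  shows "\<exists>t. complex_of_real t \<in> op_spectrum T"
proof -
  have "poly_op [:0, 1:] T \<noteq> 0 \<or> poly_op [:1, 1:] T \<noteq> 0"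
    using nontriv by auto
  then obtain c where "poly_op [:c, 1:] T \<noteq> 0"
    by blast
  then show ?thesis
    using norm_poly_op_attained_nonconst[OF T, of "[:c, 1:]"] by auto
qed

text \<open>If \<open>p * p\<close> is the constant excluded before, then
  \<open>\<bar>poly p t\<bar>\<close> equals the norm everywhere, and any spectral point
  serves.\<close>

lemma norm_poly_op_attained:
  fixes T :: "'a :: chilbert_space bounded_op"
  assumes T: "a *\<^sub>R 1 \<le> T" "T \<le> b *\<^sub>R 1" and pos: "0 < norm (poly_op p T)"
  shows "\<exists>t. complex_of_real t \<in> op_spectrum T \<and> \<bar>poly p t\<bar> = norm (poly_op p T)"
proof (cases "p * p = [:(norm (poly_op p T))\<^sup>2:]")
  case True
  have "(1 :: 'a bounded_op) \<noteq> 0"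
    using pos by (metis mult_1_left mult_zero_left norm_zero less_irrefl)
  then obtain t where t: "complex_of_real t \<in> op_spectrum T"
    using op_spectrum_nonempty[OF T] by blast
  have "(poly p t)\<^sup>2 = (norm (poly_op p T))\<^sup>2"
    using arg_cong[OF True, of "\<lambda>q. poly q t"] by (simp add: power2_eq_square)
  then have "\<bar>poly p t\<bar> = norm (poly_op p T)"
    by (metis abs_norm_cancel power2_eq_iff abs_eq_iff)
  with t show ?thesis by blast
qed (rule norm_poly_op_attained_nonconst[OF T pos])

text \<open>The estimate behind the functional calculus. On the trivial space the spectrum is empty,
  and the bound rests on \<open>0 \<le> e\<close>.\<close>

lemma norm_poly_op_le:
  assumes T: "a *\<^sub>R 1 \<le> T" "T \<le> b *\<^sub>R 1" and "0 \<le> e"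
    and le: "\<And>t. complex_of_real t \<in> op_spectrum T \<Longrightarrow> \<bar>poly p t\<bar> \<le> e"
  shows "norm (poly_op p T) \<le> e"
proof (cases "poly_op p T = 0")
  case False
  then obtain t where "complex_of_real t \<in> op_spectrum T" "\<bar>poly p t\<bar> = norm (poly_op p T)"
    using norm_poly_op_attained[OF T, of p] by auto
  with le[of t] show ?thesis by simp
qed (use \<open>0 \<le> e\<close> in simp)

section \<open>Continuous functional calculus\<close>

text \<open>Weierstrass approximation, with errors \<open>1 / (n + 1)\<close> to obtain a
  sequence.\<close>

lemma ex_uniform_limit_poly:
  fixes f :: "real \<Rightarrow> real"
  assumes "continuous_on {a..b} f"
  shows "\<exists>p. uniform_limit {a..b} (\<lambda>n. poly (p n)) f sequentially"
proof -
  have "\<exists>p. \<forall>t\<in>{a..b}. \<bar>f t - poly p t\<bar> < inverse (real (Suc n))" for n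
  proof -
    obtain g where g: "real_polynomial_function g"
      "\<And>t. t \<in> {a..b} \<Longrightarrow> \<bar>f t - g t\<bar> < inverse (real (Suc n))"
      using Stone_Weierstrass_real_polynomial_function[OF compact_Icc assms, of "inverse (real (Suc n))"]
      by auto
    then obtain c k where "g = (\<lambda>t. \<Sum>i\<le>k. c i * t ^ i)"
      by (auto simp: real_polynomial_function_iff_sum)
    then have "g t = poly (\<Sum>i\<le>k. monom (c i) i) t" for t
      by (simp add: poly_sum poly_monom)
    with g show ?thesis by metis
  qed
  then obtain p where p: "\<And>n t. t \<in> {a..b} \<Longrightarrow> \<bar>f t - poly (p n) t\<bar> < inverse (real (Suc n))"
    by metis
  have "uniform_limit {a..b} (\<lambda>n. poly (p n)) f sequentially"
  proof (rule uniform_limitI)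
    fix e :: real assume "0 < e"
    then have "\<forall>\<^sub>F n in sequentially. inverse (real (Suc n)) < e"
      using order_tendstoD(2)[OF LIMSEQ_inverse_real_of_nat] by blast
    then show "\<forall>\<^sub>F n in sequentially. \<forall>t\<in>{a..b}. dist (poly (p n) t) (f t) < e"
    proof eventually_elim
      case (elim n)
      show ?case
      proof
        fix t assume "t \<in> {a..b}"
        from p[OF this, of n] elim show "dist (poly (p n) t) (f t) < e"
          by (simp add: dist_real_def abs_minus_commute)
      qed
    qed
  qed
  then show ?thesis by blast
qed

lemma tendsto_op_apply:
  assumes "(X \<longlongrightarrow> L) F"
  shows "((\<lambda>n. op_apply (X n) x) \<longlongrightarrow> op_apply L x) F"
proof -
  have "bounded_linear (\<lambda>T. op_apply T x)"
    using norm_op_apply by (intro bounded_linear_intro[where K = "norm x"]) simp_all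
  then show ?thesis
    using assms by (rule bounded_linear.tendsto)
qed

lemma op_square_nonneg:
  assumes "selfadj_op S"
  shows "0 \<le> S * S"
proof -
  have "inner (op_apply S (op_apply S x)) x = inner (op_apply S x) (op_apply S x)" for x
    using assms unfolding selfadj_op_def by blast
  then show ?thesis
    using assms by (simp add: less_eq_op_iff selfadj_op_algebra)
qed

section \<open>The calculus for an operator with spectrum inside \<open>{a..b}\<close>\<close>

context
  fixes T :: "'a :: chilbert_space bounded_op" and a b :: real
  assumes lower: "a *\<^sub>R 1 \<le> T" and upper: "T \<le> b *\<^sub>R 1"
begin

lemma real_spectrum_subset: "{t. complex_of_real t \<in> op_spectrum T} \<subseteq> {a..b}"
  using op_spectrum_selfadj(2)[OF lower upper] by fastforce

text \<open>With \<open>p = q\<close> this is the Cauchy property; with different sequences it shows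
  that the limit does not depend on the choice.\<close>

lemma poly_op_close:
  assumes p: "uniform_limit {t. complex_of_real t \<in> op_spectrum T} (\<lambda>n. poly (p n)) f sequentially"
    and q: "uniform_limit {t. complex_of_real t \<in> op_spectrum T} (\<lambda>n. poly (q n)) f sequentially"
    and "0 < e"
  shows "\<exists>N. \<forall>i\<ge>N. \<forall>j\<ge>N. norm (poly_op (p i) T - poly_op (q j) T) < e"
proof -
  let ?\<sigma> = "{t. complex_of_real t \<in> op_spectrum T}"
  have e: "0 < e / 4" using \<open>0 < e\<close> by simp
  obtain N1 where N1: "\<forall>i\<ge>N1. \<forall>t\<in>?\<sigma>. dist (poly (p i) t) (f t) < e / 4"
    using uniform_limitD[OF p e] by (auto simp: eventually_sequentially)
  obtain N2 where N2: "\<forall>j\<ge>N2. \<forall>t\<in>?\<sigma>. dist (poly (q j) t) (f t) < e / 4"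
    using uniform_limitD[OF q e] by (auto simp: eventually_sequentially)
  have "norm (poly_op (p i) T - poly_op (q j) T) < e" if ij: "max N1 N2 \<le> i" "max N1 N2 \<le> j" for i j
  proof -
    have "\<bar>poly (p i - q j) t\<bar> \<le> e / 2" if "complex_of_real t \<in> op_spectrum T" for t
    proof -
      have "\<bar>poly (p i) t - f t\<bar> < e / 4" "\<bar>poly (q j) t - f t\<bar> < e / 4"
        using N1 N2 ij that by (auto simp: dist_real_def)
      then show ?thesis
        unfolding poly_diff by linarith
    qed
    then have "norm (poly_op (p i - q j) T) \<le> e / 2"
      using \<open>0 < e\<close> by (intro norm_poly_op_le[OF lower upper]) auto
    then show ?thesis
      using \<open>0 < e\<close> by (simp add: poly_op_diff)
  qed
  then show ?thesis by blast
qed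

text \<open>Shows that the description in \<open>cfc\<close> denotes. Continuity on the whole
  interval supplies one approximating sequence \<open>q\<close>; completeness gives its limit, and
  every other sequence is close to \<open>q\<close>. The existence of \<open>q\<close> also yields
  uniqueness.\<close>

lemma cfc_tendsto:
  assumes f: "continuous_on {a..b} f"
    and p: "uniform_limit {t. complex_of_real t \<in> op_spectrum T} (\<lambda>n. poly (p n)) f sequentially"
  shows "(\<lambda>n. poly_op (p n) T) \<longlonglongrightarrow> cfc f T"
proof -
  let ?\<sigma> = "{t. complex_of_real t \<in> op_spectrum T}"
  obtain q where "uniform_limit {a..b} (\<lambda>n. poly (q n)) f sequentially"
    using ex_uniform_limit_poly[OF f] by blast
  then have q: "uniform_limit ?\<sigma> (\<lambda>n. poly (q n)) f sequentially"
    using real_spectrum_subset by (rule uniform_limit_on_subset)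
  have "Cauchy (\<lambda>n. poly_op (q n) T)"
    using poly_op_close[OF q q] unfolding Cauchy_iff by blast
  then obtain L where L: "(\<lambda>n. poly_op (q n) T) \<longlonglongrightarrow> L"
    by (metis Cauchy_convergent convergent_def)
  have lim: "(\<lambda>n. poly_op (p n) T) \<longlonglongrightarrow> L"
    if p: "uniform_limit ?\<sigma> (\<lambda>n. poly (p n)) f sequentially" for p
  proof -
    have "(\<lambda>n. poly_op (p n) T - poly_op (q n) T) \<longlonglongrightarrow> 0"
      unfolding LIMSEQ_iff using poly_op_close[OF p q] by (metis diff_zero)
    from tendsto_add[OF this L] show ?thesis by simp
  qed
  have "cfc f T = L"
    unfolding cfc_def
  proof (rule the_equality)
    fix S
    assume "\<forall>p :: nat \<Rightarrow> real poly. uniform_limit ?\<sigma> (\<lambda>n. poly (p n)) f sequentially \<longrightarrow>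
      (\<lambda>n. poly_op (p n) T) \<longlonglongrightarrow> S"
    with q L show "S = L" using LIMSEQ_unique by blast
  qed (use lim in blast)
  with lim[OF p] show ?thesis by simp
qed

lemma cfc_eqI:
  assumes "continuous_on {a..b} f" "uniform_limit {a..b} (\<lambda>n. poly (p n)) f sequentially"
    and "(\<lambda>n. poly_op (p n) T) \<longlonglongrightarrow> S"
  shows "cfc f T = S"
  using cfc_tendsto[OF assms(1) uniform_limit_on_subset[OF assms(2) real_spectrum_subset]] assms(3)
  by (rule LIMSEQ_unique)

lemma cfc_approx:
  assumes "continuous_on {a..b} f"
  obtains p where "uniform_limit {a..b} (\<lambda>n. poly (p n)) f sequentially"
    "(\<lambda>n. poly_op (p n) T) \<longlonglongrightarrow> cfc f T"
  using ex_uniform_limit_poly[OF assms] cfc_tendsto[OF assms]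
    uniform_limit_on_subset[OF _ real_spectrum_subset] by blast

lemma cfc_poly: "cfc (poly p) T = poly_op p T"
  by (rule cfc_eqI[where p = "\<lambda>_. p"]) (auto intro!: continuous_intros uniform_limit_const)

lemma cfc_cong:
  assumes f: "continuous_on {a..b} f" and eq: "\<And>t. t \<in> {a..b} \<Longrightarrow> f t = g t"
  shows "cfc f T = cfc g T"
proof -
  obtain p where p: "uniform_limit {a..b} (\<lambda>n. poly (p n)) f sequentially"
    "(\<lambda>n. poly_op (p n) T) \<longlonglongrightarrow> cfc f T"
    using cfc_approx[OF f] by blast
  have "uniform_limit {a..b} (\<lambda>n. poly (p n)) g sequentially"
    using p(1) eq by (subst (asm) uniform_limit_cong'[where g = "\<lambda>n. poly (p n)" and i = g]) auto
  moreover have "continuous_on {a..b} g"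
    using continuous_on_cong[of "{a..b}" "{a..b}" f g] f eq by blast
  ultimately show ?thesis
    using cfc_eqI p(2) by metis
qed

lemma cfc_diff:
  assumes f: "continuous_on {a..b} f" and g: "continuous_on {a..b} g"
  shows "cfc (\<lambda>t. f t - g t) T = cfc f T - cfc g T"
proof -
  obtain p where p: "uniform_limit {a..b} (\<lambda>n. poly (p n)) f sequentially"
    "(\<lambda>n. poly_op (p n) T) \<longlonglongrightarrow> cfc f T"
    using cfc_approx[OF f] by blast
  obtain q where q: "uniform_limit {a..b} (\<lambda>n. poly (q n)) g sequentially"
    "(\<lambda>n. poly_op (q n) T) \<longlonglongrightarrow> cfc g T"
    using cfc_approx[OF g] by blast
  show ?thesis
  proof (rule cfc_eqI[where p = "\<lambda>n. p n - q n"])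
    show "uniform_limit {a..b} (\<lambda>n. poly (p n - q n)) (\<lambda>t. f t - g t) sequentially"
      unfolding poly_diff by (rule uniform_limit_minus[OF p(1) q(1)])
    show "(\<lambda>n. poly_op (p n - q n) T) \<longlonglongrightarrow> cfc f T - cfc g T"
      using tendsto_diff[OF p(2) q(2)] by (simp add: poly_op_diff)
  qed (intro continuous_intros f g)
qed

lemma cfc_mult:
  assumes f: "continuous_on {a..b} f" and g: "continuous_on {a..b} g"
  shows "cfc (\<lambda>t. f t * g t) T = cfc f T * cfc g T"
proof -
  obtain p where p: "uniform_limit {a..b} (\<lambda>n. poly (p n)) f sequentially"
    "(\<lambda>n. poly_op (p n) T) \<longlonglongrightarrow> cfc f T"
    using cfc_approx[OF f] by blast
  obtain q where q: "uniform_limit {a..b} (\<lambda>n. poly (q n)) g sequentially"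
    "(\<lambda>n. poly_op (q n) T) \<longlonglongrightarrow> cfc g T"
    using cfc_approx[OF g] by blast
  \<comment> \<open>Uniform convergence passes to products because the limit functions are
    bounded.\<close>
  have "bounded (f ` {a..b})" "bounded (g ` {a..b})"
    using f g by (auto intro!: compact_imp_bounded compact_continuous_image)
  note lim = uniform_lim_mult[OF p(1) q(1) this]
  show ?thesis
  proof (rule cfc_eqI[where p = "\<lambda>n. p n * q n"])
    show "uniform_limit {a..b} (\<lambda>n. poly (p n * q n)) (\<lambda>t. f t * g t) sequentially"
      unfolding poly_mult by (rule lim)
    show "(\<lambda>n. poly_op (p n * q n) T) \<longlonglongrightarrow> cfc f T * cfc g T"
      using tendsto_mult[OF p(2) q(2)] by (simp add: poly_op_mult)
  qed (intro continuous_intros f g)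
qed

lemma cfc_cmult:
  assumes "continuous_on {a..b} f"
  shows "cfc (\<lambda>t. c * f t) T = c *\<^sub>R cfc f T"
  using cfc_mult[of "poly [:c:]" f] assms cfc_poly[of "[:c:]"] by simp

lemma selfadj_cfc:
  assumes "continuous_on {a..b} f"
  shows "selfadj_op (cfc f T)"
proof -
  obtain p where p: "(\<lambda>n. poly_op (p n) T) \<longlonglongrightarrow> cfc f T"
    using cfc_approx[OF assms] by blast
  have "inner (op_apply (cfc f T) x) y = inner x (op_apply (cfc f T) y)" for x y
  proof (rule LIMSEQ_unique)
    show "(\<lambda>n. inner (op_apply (poly_op (p n) T) x) y) \<longlonglongrightarrow> inner (op_apply (cfc f T) x) y"
      by (intro tendsto_intros tendsto_op_apply p)
    have "(\<lambda>n. inner x (op_apply (poly_op (p n) T) y)) \<longlonglongrightarrow> inner x (op_apply (cfc f T) y)"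
      by (intro tendsto_intros tendsto_op_apply p)
    then show "(\<lambda>n. inner (op_apply (poly_op (p n) T) x) y) \<longlonglongrightarrow> inner x (op_apply (cfc f T) y)"
      using selfadj_poly_op[OF selfadj_op_lower[OF lower]] by (simp add: selfadj_op_def)
  qed
  then show ?thesis by (simp add: selfadj_op_def)
qed

text \<open>The difference \<open>g - f\<close> is the square of a continuous function, hence
  \<open>cfc g T - cfc f T\<close> is the square of a self-adjoint operator.\<close>

lemma cfc_mono:
  assumes f: "continuous_on {a..b} f" and g: "continuous_on {a..b} g"
    and le: "\<And>t. t \<in> {a..b} \<Longrightarrow> f t \<le> g t"
  shows "cfc f T \<le> cfc g T"
proof -
  let ?h = "\<lambda>t. sqrt (g t - f t)"
  have h: "continuous_on {a..b} ?h"
    by (intro continuous_intros f g)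
  have "cfc g T - cfc f T = cfc (\<lambda>t. g t - f t) T"
    using f g by (simp add: cfc_diff)
  also have "\<dots> = cfc (\<lambda>t. ?h t * ?h t) T"
    by (intro cfc_cong continuous_intros f g) (simp add: le)
  also have "\<dots> = cfc ?h T * cfc ?h T"
    by (intro cfc_mult h)
  finally show ?thesis
    using op_square_nonneg[OF selfadj_cfc[OF h]] by (metis diff_ge_0_iff_ge)
qed

lemma cfc_le_linear:
  assumes "continuous_on {a..b} f" "\<And>t. t \<in> {a..b} \<Longrightarrow> f t \<le> c + d * t"
  shows "cfc f T \<le> c *\<^sub>R 1 + d *\<^sub>R T"
proof -
  have "cfc f T \<le> cfc (poly [:c, d:]) T"
    using assms by (intro cfc_mono) (auto intro!: continuous_intros simp: mult.commute)
  then show ?thesis by (simp add: cfc_poly mult_scaleR_right)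
qed

lemma cfc_nonneg:
  assumes "continuous_on {a..b} f" "\<And>t. t \<in> {a..b} \<Longrightarrow> 0 \<le> f t"
  shows "0 \<le> cfc f T"
  using cfc_mono[of "poly 0" f] cfc_poly[of 0] assms by simp

end


section \<open>The norm of a product of positive operators\<close>

lemma inner_le_quarter:
  assumes A: "selfadj_op A" and B: "selfadj_op B"
    and pos: "\<And>x. 0 \<le> inner (op_apply A x) x" "\<And>x. 0 \<le> inner (op_apply B x) x"
    and sum: "\<And>x. inner (op_apply A x) x + inner (op_apply B x) x \<le> (norm x)\<^sup>2"
  shows "2 * inner (op_apply A y) (op_apply B x) \<le> ((norm x)\<^sup>2 + (norm y)\<^sup>2) / 4"
proof -
  \<comment> \<open>After bounding the \<open>w\<close>-quadratic terms by
    \<open>(norm w)\<^sup>2\<close>, the sum of the two forms is minimized at this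
    \<open>w\<close>.\<close>
  define w where "w = op_apply A y + op_apply B x"
  have "inner (op_apply A (y - w)) (y - w) =
      inner (op_apply A y) y - 2 * inner (op_apply A y) w + inner (op_apply A w) w"
    using A by (simp add: selfadj_op_def inner_diff_left inner_diff_right)
      (metis inner_commute)
  moreover have "inner (op_apply B (x - w)) (x - w) =
      inner (op_apply B x) x - 2 * inner (op_apply B x) w + inner (op_apply B w) w"
    using B by (simp add: selfadj_op_def inner_diff_left inner_diff_right)
      (metis inner_commute)
  moreover have "inner (op_apply A y) w + inner (op_apply B x) w = (norm w)\<^sup>2"
    unfolding power2_norm_eq_inner by (simp add: w_def inner_add_left)
  ultimately have w: "(norm w)\<^sup>2 \<le> inner (op_apply A y) y + inner (op_apply B x) x"
    using pos(1)[of "y - w"] pos(2)[of "x - w"] sum[of w] by linarith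
  have "(norm w)\<^sup>2 = (norm (op_apply A y))\<^sup>2 + 2 * inner (op_apply A y) (op_apply B x)
      + (norm (op_apply B x))\<^sup>2"
    unfolding power2_norm_eq_inner w_def by (simp add: inner_add_left inner_add_right inner_commute)
  \<comment> \<open>Expands the square of \<open>u - v / 2\<close>; with
    \<open>u = op_apply A y\<close> and \<open>v = y\<close> it reads
    \<open>A - A\<^sup>2 \<le> 1/4\<close>.\<close>
  moreover have "inner u v - (norm u)\<^sup>2 \<le> (norm v)\<^sup>2 / 4" for u v :: 'a
    using inner_ge_zero[of "u - (1 / 2) *\<^sub>R v"] unfolding power2_norm_eq_inner
    by (simp add: inner_diff_left inner_diff_right inner_commute)
  note this[of "op_apply A y" y] this[of "op_apply B x" x]
  ultimately show ?thesis
    unfolding add_divide_distrib using w by linarith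
qed

lemma norm_mult_le_quarter:
  assumes "0 \<le> A" "0 \<le> B" "A + B \<le> 1"
  shows "norm (op_apply A (op_apply B x)) \<le> norm x / 4"
proof -
  have AB: "selfadj_op A" "selfadj_op B"
    and pos: "\<And>x. 0 \<le> inner (op_apply A x) x" "\<And>x. 0 \<le> inner (op_apply B x) x"
    and sum: "\<And>x. inner (op_apply A x) x + inner (op_apply B x) x \<le> (norm x)\<^sup>2"
    using assms by (simp_all add: less_eq_op_iff inner_add_left power2_norm_eq_inner)
  define z where "z = op_apply A (op_apply B x)"
  show ?thesis
  proof (cases "z = 0")
    case False
    \<comment> \<open>\<open>y\<close> points along \<open>z\<close> to maximize the inner product,
      and has the norm of \<open>x\<close> to balance the two squares.\<close>
    define y where "y = (norm x / norm z) *\<^sub>R z"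
    have y: "norm y = norm x" "inner y z = norm x * norm z"
      using False by (simp_all add: y_def flip: power2_norm_eq_inner) (simp add: power2_eq_square)
    have "inner (op_apply A y) (op_apply B x) = inner y z"
      using AB(1) by (simp add: selfadj_op_def z_def)
    with inner_le_quarter[OF AB pos sum, of y x] y
    have *: "norm x * (4 * norm z) \<le> norm x * norm x"
      by (simp add: power2_eq_square)
    have "x \<noteq> 0" using False by (auto simp: z_def)
    with * have "4 * norm z \<le> norm x" by simp
    then show ?thesis by (simp add: z_def)
  qed (simp add: z_def)
qed


section \<open>The operator inequality\<close>

text \<open>Isolates what is used of the map: one linear inequality, applied with
  \<open>c = M * m\<close> and \<open>S = M + m\<close>.\<close>

lemma op_powr_le:
  fixes X B :: "'a :: chilbert_space bounded_op"
  assumes "0 < m" "0 < c" "0 < S" "2 \<le> p"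
    and X: "0 \<le> X" and B: "m *\<^sub>R 1 \<le> B" and sum: "c *\<^sub>R X + B \<le> S *\<^sub>R 1"
  shows "op_powr X p \<le> ((S\<^sup>2 / c) powr p / 16) *\<^sub>R op_powr B (- p)"
proof -
  have "(0 :: 'a bounded_op) \<le> 1"
    by (simp add: less_eq_op_iff selfadj_op_algebra)
  then have "0 \<le> m *\<^sub>R (1 :: 'a bounded_op)"
    using \<open>0 < m\<close> by (simp add: scaleR_nonneg_nonneg)
  with B have "0 \<le> B" by simp
  then have "c *\<^sub>R X \<le> S *\<^sub>R 1"
    using sum by (metis add_increasing2 order.refl order.trans)
  then have "(1 / c) *\<^sub>R c *\<^sub>R X \<le> (1 / c) *\<^sub>R S *\<^sub>R 1"
    using \<open>0 < c\<close> by (intro scaleR_left_mono) auto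
  then have X_le: "X \<le> (S / c) *\<^sub>R 1"
    using \<open>0 < c\<close> by simp
  have X_ge: "0 *\<^sub>R 1 \<le> X"
    using X by simp
  have "0 \<le> c *\<^sub>R X"
    using X \<open>0 < c\<close> by (simp add: scaleR_nonneg_nonneg)
  then have B_le: "B \<le> S *\<^sub>R 1"
    using sum by (metis add_increasing order.refl order.trans)
  \<comment> \<open>Rescaling moves both spectra into \<open>[0, 1]\<close>, and the exponent
    \<open>p / 2\<close> turns into \<open>p\<close> after squaring. \<open>h\<close> is the
    reciprocal of \<open>g\<close>, continuous because \<open>B\<close> is bounded below by
    \<open>m > 0\<close>.\<close>
  define f where "f = (\<lambda>t. (c / S * t) powr (p / 2))"
  define g where "g = (\<lambda>t. (t / S) powr (p / 2))"
  define h where "h = (\<lambda>t. (t / S) powr (- (p / 2)))"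
  have cont_f: "continuous_on {0..S / c} f"
    unfolding f_def using assms by (intro continuous_on_powr' continuous_intros) auto
  have cont_g: "continuous_on {m..S} g" and cont_h: "continuous_on {m..S} h"
    unfolding g_def h_def using assms by (intro continuous_on_powr' continuous_intros; auto)+
  have powr_le: "u powr (p / 2) \<le> u" if "0 \<le> u" "u \<le> 1" for u :: real
    using powr_mono'[of 1 "p / 2" u] that \<open>2 \<le> p\<close> by simp
  define A1 where "A1 = cfc f X"
  define B1 where "B1 = cfc g B"
  define C1 where "C1 = cfc h B"
  have "A1 \<le> 0 *\<^sub>R 1 + (c / S) *\<^sub>R X"
    unfolding A1_def
  proof (rule cfc_le_linear[OF X_ge X_le cont_f])
    fix t assume "t \<in> {0..S / c}"
    then show "f t \<le> 0 + c / S * t"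
      using powr_le[of "c / S * t"] assms by (simp add: f_def field_simps)
  qed
  moreover have "B1 \<le> 0 *\<^sub>R 1 + (1 / S) *\<^sub>R B"
    unfolding B1_def
  proof (rule cfc_le_linear[OF B B_le cont_g])
    fix t assume "t \<in> {m..S}"
    then show "g t \<le> 0 + 1 / S * t"
      using powr_le[of "t / S"] assms by (simp add: g_def)
  qed
  ultimately have "A1 + B1 \<le> (c / S) *\<^sub>R X + (1 / S) *\<^sub>R B"
    by (intro add_mono) simp_all
  also have "\<dots> = (1 / S) *\<^sub>R (c *\<^sub>R X + B)"
    by (simp add: scaleR_add_right)
  also have "\<dots> \<le> (1 / S) *\<^sub>R S *\<^sub>R 1"
    using sum \<open>0 < S\<close> by (intro scaleR_left_mono) auto
  finally have sum1: "A1 + B1 \<le> 1"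
    using \<open>0 < S\<close> by simp
  have "0 \<le> A1" "0 \<le> B1"
    unfolding A1_def B1_def
    by (intro cfc_nonneg[OF X_ge X_le cont_f] cfc_nonneg[OF B B_le cont_g]; simp add: f_def g_def)+
  note quarter = norm_mult_le_quarter[OF this sum1]
  have "B1 * C1 = cfc (\<lambda>t. g t * h t) B"
    by (simp add: B1_def C1_def cfc_mult[OF B B_le cont_g cont_h])
  also have "\<dots> = cfc (poly [:1:]) B"
    using assms by (intro cfc_cong[OF B B_le] continuous_on_mult cont_g cont_h)
      (simp add: g_def h_def flip: powr_add)
  also have "\<dots> = 1"
    unfolding cfc_poly[OF B B_le] by simp
  finally have inv: "op_apply B1 (op_apply C1 y) = y" for y
    using op_apply_simps(8)[of B1 C1 y] by simp
  have "A1 * A1 = cfc (\<lambda>t. f t * f t) X"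
    by (simp add: A1_def cfc_mult[OF X_ge X_le cont_f cont_f])
  also have "\<dots> = cfc (\<lambda>t. (c / S) powr p * t powr p) X"
  proof (rule cfc_cong[OF X_ge X_le])
    fix t assume "t \<in> {0..S / c}"
    then have "f t * f t = (c / S * t) powr p"
      by (simp add: f_def flip: powr_add)
    also have "\<dots> = (c / S) powr p * t powr p"
      by (rule powr_mult)
    finally show "f t * f t = (c / S) powr p * t powr p" .
  qed (intro continuous_intros cont_f)
  also have "\<dots> = (c / S) powr p *\<^sub>R op_powr X p"
    unfolding op_powr_def using assms
    by (intro cfc_cmult[OF X_ge X_le] continuous_on_powr' continuous_intros) auto
  finally have A1_sq: "A1 * A1 = (c / S) powr p *\<^sub>R op_powr X p" .
  have "C1 * C1 = cfc (\<lambda>t. h t * h t) B"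
    by (simp add: C1_def cfc_mult[OF B B_le cont_h cont_h])
  also have "\<dots> = cfc (\<lambda>t. S powr p * t powr (- p)) B"
  proof (rule cfc_cong[OF B B_le])
    fix t assume "t \<in> {m..S}"
    then have "h t * h t = (t / S) powr (- p)"
      by (simp add: h_def flip: powr_add)
    also have "\<dots> = S powr p * t powr (- p)"
      using \<open>t \<in> _\<close> assms by (simp add: powr_divide powr_minus field_simps)
    finally show "h t * h t = S powr p * t powr (- p)" .
  qed (intro continuous_intros cont_h)
  also have "\<dots> = S powr p *\<^sub>R op_powr B (- p)"
    unfolding op_powr_def using assms
    by (intro cfc_cmult[OF B B_le] continuous_on_powr' continuous_intros) auto
  finally have C1_sq: "C1 * C1 = S powr p *\<^sub>R op_powr B (- p)" .
  have sa: "selfadj_op A1" "selfadj_op C1"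
    unfolding A1_def C1_def by (rule selfadj_cfc[OF X_ge X_le cont_f] selfadj_cfc[OF B B_le cont_h])+
  have "A1 * A1 \<le> (1 / 16) *\<^sub>R (C1 * C1)"
    unfolding less_eq_op_iff
  proof (intro conjI allI)
    show "selfadj_op ((1 / 16) *\<^sub>R (C1 * C1) - A1 * A1)"
      using sa by (intro selfadj_op_algebra) auto
    fix y
    \<comment> \<open>Inserting \<open>op_apply C1 y\<close> into the bound for
      \<open>A1 * B1\<close> cancels \<open>B1\<close>, since \<open>C1\<close> is its right
      inverse.\<close>
    have "(norm (op_apply A1 y))\<^sup>2 \<le> (norm (op_apply C1 y) / 4)\<^sup>2"
      using quarter[of "op_apply C1 y"] by (intro power_mono) (simp_all add: inv)
    then show "inner (op_apply (A1 * A1) y) y \<le> inner (op_apply ((1 / 16) *\<^sub>R (C1 * C1)) y) y"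
      using sa by (simp add: selfadj_op_def power2_norm_eq_inner power_divide)
  qed
  then have "(S / c) powr p *\<^sub>R (A1 * A1) \<le> (S / c) powr p *\<^sub>R (1 / 16) *\<^sub>R (C1 * C1)"
    by (intro scaleR_left_mono) auto
  moreover have "(S / c) powr p * (c / S) powr p = 1"
    using assms by (simp flip: powr_mult)
  moreover have "(S / c) powr p * S powr p = (S\<^sup>2 / c) powr p"
    using assms by (simp add: power2_eq_square flip: powr_mult)
  ultimately show ?thesis
    by (simp add: A1_sq C1_sq)
qed

text \<open>The exponential \<open>g\<close> lies below its chord, which joins \<open>(m, 1/m)\<close> and \<open>(M, 1/M)\<close>.\<close>

lemma geometric_interpolation_le_chord:
  fixes m M t :: real
  assumes "0 < m" "m < M" "t \<in> {m..M}"
  shows "m powr ((t - M) / (M - m)) * M powr ((m - t) / (M - m)) \<le> (M + m - t) / (M * m)"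
proof -
  \<comment> \<open>The weight with \<open>t = l * m + (1 - l) * M\<close>. The left side is then a
    weighted geometric mean of \<open>1 / m\<close> and \<open>1 / M\<close>, and Young's inequality
    compares it with the arithmetic mean.\<close>
  define l where "l = (M - t) / (M - m)"
  have l: "0 \<le> l" "l \<le> 1" "1 - l = (t - m) / (M - m)"
    using assms by (simp_all add: l_def field_simps)
  have "(t - M) / (M - m) = - l" "(m - t) / (M - m) = - (1 - l)"
    unfolding l(3) by (simp_all add: l_def minus_divide_left)
  then have "m powr ((t - M) / (M - m)) * M powr ((m - t) / (M - m))
      = inverse m powr l * inverse M powr (1 - l)"
    using assms by (simp only: powr_minus inverse_powr)
  also have "\<dots> \<le> l * inverse m + (1 - l) * inverse M"
    using assms l by (intro Youngs_inequality_0) auto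
  also have "\<dots> = (l * (M - m) + m) / (M * m)"
    using assms by (simp add: field_simps)
  also have "l * (M - m) + m = M + m - t"
    using assms by (simp add: l_def)
  finally show ?thesis .
qed

theorem theorem3p1:
  fixes A :: "'h :: chilbert_space bounded_op"
    and \<Phi> :: "'h bounded_op \<Rightarrow> 'k :: chilbert_space bounded_op"
    and m M :: real
  assumes "0 \<le> A"
    and "0 < m" and "m < M"
    and "m *\<^sub>R 1 \<le> A" and "A \<le> M *\<^sub>R 1"
    and "clinear \<Phi>" and "positive_map \<Phi>" and "\<Phi> 1 = 1"
  shows "(\<forall>p::real. 2 \<le> p \<longrightarrow>
      op_powr (\<Phi> (cfc (\<lambda>t. m powr ((t - M) / (M - m)) * M powr ((m - t) / (M - m))) A)) p
      \<le> (((M + m)\<^sup>2 / (4 powr (2 / p) * M * m)) powr p) *\<^sub>R op_powr (\<Phi> A) (- p))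
    \<and> op_powr (\<Phi> (cfc (\<lambda>t. m powr ((t - M) / (M - m)) * M powr ((m - t) / (M - m))) A)) 2
      \<le> ((M + m)\<^sup>2 / (4 * M * m))\<^sup>2 *\<^sub>R op_powr (\<Phi> A) (- 2)"
proof -
  define g where "g = (\<lambda>t. m powr ((t - M) / (M - m)) * M powr ((m - t) / (M - m)))"
  note A = \<open>m *\<^sub>R 1 \<le> A\<close> \<open>A \<le> M *\<^sub>R 1\<close>
  have Mm: "0 < M * m" "0 < M + m"
    using assms by simp_all
  interpret Phi: Vector_Spaces.linear scaleC scaleC \<Phi>
    by (rule \<open>clinear \<Phi>\<close>)
  have Phi_scaleR: "\<Phi> (r *\<^sub>R T) = r *\<^sub>R \<Phi> T" for r T
    by (simp add: scaleR_scaleC Phi.scale)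
  have Phi_mono: "\<Phi> S \<le> \<Phi> T" if "S \<le> T" for S T
    using \<open>positive_map \<Phi>\<close> that unfolding positive_map_def
    by (metis Phi.diff diff_ge_0_iff_ge)
  have cont: "continuous_on {m..M} g"
    unfolding g_def using assms by (intro continuous_intros) auto
  have nonneg: "0 \<le> \<Phi> (cfc g A)"
    using Phi_mono[OF cfc_nonneg[OF A cont]] assms by (simp add: g_def Phi.zero)
  \<comment> \<open>The chord is affine in \<open>A\<close>, so \<open>\<Phi>\<close> carries the
    bound over to \<open>\<Phi> A\<close> by linearity and \<open>\<Phi> 1 = 1\<close>.\<close>
  have "cfc g A \<le> ((M + m) / (M * m)) *\<^sub>R 1 + (- 1 / (M * m)) *\<^sub>R A"
  proof (rule cfc_le_linear[OF A cont])
    fix t assume "t \<in> {m..M}"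
    then show "g t \<le> (M + m) / (M * m) + - 1 / (M * m) * t"
      using geometric_interpolation_le_chord[of m M t] assms
      by (simp add: g_def diff_divide_distrib)
  qed
  from Phi_mono[OF this]
  have "\<Phi> (cfc g A) \<le> ((M + m) / (M * m)) *\<^sub>R 1 + (- 1 / (M * m)) *\<^sub>R \<Phi> A"
    by (simp only: Phi.add Phi_scaleR \<open>\<Phi> 1 = 1\<close>)
  then have "(M * m) *\<^sub>R \<Phi> (cfc g A)
      \<le> (M * m) *\<^sub>R (((M + m) / (M * m)) *\<^sub>R 1 + (- 1 / (M * m)) *\<^sub>R \<Phi> A)"
    using Mm by (intro scaleR_left_mono) auto
  also have "\<dots> = (M + m) *\<^sub>R 1 - \<Phi> A"
    using assms by (simp add: scaleR_right_diff_distrib)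
  finally have sum: "(M * m) *\<^sub>R \<Phi> (cfc g A) + \<Phi> A \<le> (M + m) *\<^sub>R 1"
    by (simp add: le_diff_eq)
  have lower: "m *\<^sub>R 1 \<le> \<Phi> A"
    using Phi_mono[OF A(1)] by (simp add: Phi_scaleR \<open>\<Phi> 1 = 1\<close>)
  have main: "op_powr (\<Phi> (cfc g A)) p
      \<le> (((M + m)\<^sup>2 / (M * m)) powr p / 16) *\<^sub>R op_powr (\<Phi> A) (- p)" if "2 \<le> p" for p
    by (rule op_powr_le[OF \<open>0 < m\<close> Mm that nonneg lower sum])
  \<comment> \<open>The exponent \<open>2 / p\<close> makes the \<open>p\<close>-th power of
    \<open>4 powr (2 / p)\<close> equal to 16, the square of the 4 in the norm bound
    \<open>1/4\<close>.\<close>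
  have const: "((M + m)\<^sup>2 / (4 powr (2 / p) * M * m)) powr p = ((M + m)\<^sup>2 / (M * m)) powr p / 16"
    if "2 \<le> p" for p
  proof -
    have "(M + m)\<^sup>2 / (4 powr (2 / p) * M * m) = ((M + m)\<^sup>2 / (M * m)) / 4 powr (2 / p)"
      by simp
    also have "\<dots> powr p = ((M + m)\<^sup>2 / (M * m)) powr p / (4 powr (2 / p)) powr p"
      by (rule powr_divide)
    also have "(4 powr (2 / p)) powr p = (16 :: real)"
      using that by (simp add: powr_powr)
    finally show ?thesis .
  qed
  have const2: "((M + m)\<^sup>2 / (4 * M * m))\<^sup>2 = ((M + m)\<^sup>2 / (M * m)) powr 2 / 16"
    using Mm by (simp add: power_divide power_mult_distrib)
  have "op_powr (\<Phi> (cfc g A)) 2 \<le> ((M + m)\<^sup>2 / (4 * M * m))\<^sup>2 *\<^sub>R op_powr (\<Phi> A) (- 2)"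
    unfolding const2 by (rule main[OF order.refl])
  moreover have "op_powr (\<Phi> (cfc g A)) p
      \<le> (((M + m)\<^sup>2 / (4 powr (2 / p) * M * m)) powr p) *\<^sub>R op_powr (\<Phi> A) (- p)"
    if "2 \<le> p" for p
    unfolding const[OF that] by (rule main[OF that])
  ultimately show ?thesis
    unfolding g_def by blast
qed

end
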